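(* Let $J,R,Q,E\in\mathbb{R}^{n\times n}$ with $J=-J^\top$, $R=R^\top\ge0$, $Q^\top E=E^\top Q\ge0$. The pencil $P(s)=sE-(J-R)Q$ is regular with index at most one if and only if $$\ker E\cap\ker(RQ)\cap(JQ)^{-1}\operatorname{im}E=\{0\}.$$
   Context: $(JQ)^{-1}\operatorname{im}E=\{x:JQx\in\operatorname{im}E\}$ denotes the pre-image. A pencil $sE-A$ is regular if $\mu E-A$ is invertible for some $\mu\in\mathbb{C}$. Its index is the maximal length $k+1$ of tuples $(x_0,\dots,x_k)$ of non-zero vectors with $Ex_0=0$, $Ex_j=Ax_{j-1}$ for $j=1,\dots,k$ (index $0$ if $\ker E=\{0\}$). *)

theory Defs
  imports "HOL-Analysis.Analysis" "HOL-Library.Extended_Nat"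
begin

definition pos_semidef :: "real^'n^'n \<Rightarrow> bool" where
  "pos_semidef M \<longleftrightarrow> transpose M = M \<and> (\<forall>x. 0 \<le> x \<bullet> (M *v x))"

definition mat_ker :: "real^'n^'m \<Rightarrow> (real^'n) set" where
  "mat_ker M = {x. M *v x = 0}"

definition mat_im :: "real^'n^'m \<Rightarrow> (real^'m) set" where
  "mat_im M = range ((*v) M)"

text \<open>The matrix pencil \<open>s E - A\<close> is represented by the pair \<open>E\<close>, \<open>A\<close>. The coefficients
  are real, but the evaluation point \<open>\<mu>\<close> ranges over the complex numbers.\<close>

definition pencil_at :: "real^'n^'n \<Rightarrow> real^'n^'n \<Rightarrow> complex \<Rightarrow> complex^'n^'n" where
  "pencil_at E A \<mu> = (\<chi> i j. \<mu> * of_real (E $ i $ j) - of_real (A $ i $ j))"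

definition regular_pencil :: "real^'n^'n \<Rightarrow> real^'n^'n \<Rightarrow> bool" where
  "regular_pencil E A \<longleftrightarrow> (\<exists>\<mu>. invertible (pencil_at E A \<mu>))"

text \<open>The list \<open>xs\<close> is the tuple \<open>(x\<^sub>0, \<dots>, x\<^sub>k)\<close>, so \<open>length xs = k + 1\<close>.\<close>

definition pencil_chain :: "real^'n^'n \<Rightarrow> real^'n^'n \<Rightarrow> (real^'n) list \<Rightarrow> bool" where
  "pencil_chain E A xs \<longleftrightarrow>
     xs \<noteq> [] \<and> (\<forall>x\<in>set xs. x \<noteq> 0) \<and> E *v (xs ! 0) = 0 \<and>
     (\<forall>j\<in>{1..<length xs}. E *v (xs ! j) = A *v (xs ! (j - 1)))"

text \<open>A supremum in \<open>enat\<close>: it is \<open>0\<close> if there are no chains, that is, if the kernel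
  of \<open>E\<close> is trivial, and \<open>\<infinity>\<close> if there are chains of unbounded length, which can happen
  only for singular pencils.\<close>

definition pencil_index :: "real^'n^'n \<Rightarrow> real^'n^'n \<Rightarrow> enat" where
  "pencil_index E A = (SUP xs\<in>{xs. pencil_chain E A xs}. enat (length xs))"

end

(* Regularity with index at most one says, for any pencil s E - A, that no non-zero x in ker E has
   A x in im E. For A = (J - R) Q and such an x, with A x = E y, pairing with Q x gives
   0 = (E x) . (Q y) = (Q x) . (E y) = - (Q x) . (R Q x), since J is skew. Hence R Q x = 0 by
   semidefiniteness, and J Q x = A x lies in im E. *)

theory Submission
  imports Defs
begin

text \<open>At a zero \<open>x\<close> of the quadratic form, moving to
  \<open>x - t *\<^sub>R y\<close> with \<open>y = M *v x\<close> changes its value by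
  \<open>t * (t * c) - 2 * t * a\<close>, where \<open>a\<close> is the squared norm of
  \<open>y\<close>. For small positive \<open>t\<close> the linear term wins, so nonnegativity
  forces \<open>a = 0\<close>.\<close>

lemma pos_semidef_mult_eq_0:
  fixes M :: "real^'n^'n"
  assumes "pos_semidef M" and "x \<bullet> (M *v x) = 0"
  shows "M *v x = 0"
proof -
  define y where "y = M *v x"
  define c where "c = y \<bullet> (M *v y)"
  define a where "a = y \<bullet> y"
  \<comment> \<open>The \<open>+ 1\<close> keeps the denominator positive even if
    \<open>c = 0\<close>. This choice gives \<open>t * c \<le> a\<close>, so the quadratic term
    cancels at most half of the linear one.\<close>
  define t where "t = a / (c + 1)"
  have M: "transpose M = M" "\<And>z. 0 \<le> z \<bullet> (M *v z)"
    using assms(1) by (auto simp: pos_semidef_def)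
  have c: "c \<ge> 0" and a: "a \<ge> 0" by (auto simp: c_def a_def M)
  have sym: "x \<bullet> (M *v y) = a"
    using dot_lmul_matrix[of x M y] M(1) by (metis a_def y_def transpose_matrix_vector)
  have "0 \<le> (x - t *\<^sub>R y) \<bullet> (M *v (x - t *\<^sub>R y))" by (rule M)
  also have "\<dots> = t * (t * c) - 2 * t * a"
    using assms(2) sym
    by (simp add: matrix_vector_mult_diff_distrib matrix_vector_mult_scaleR inner_diff_left
        inner_diff_right c_def a_def algebra_simps flip: y_def)
  also have "\<dots> \<le> t * a - 2 * t * a"
  proof -
    have "t * c \<le> a" "t \<ge> 0" using a c by (auto simp: t_def divide_simps algebra_simps)
    then show ?thesis using mult_left_mono[of "t * c" a t] by linarith
  qed
  also have "\<dots> = - (a * a / (c + 1))" by (simp add: t_def)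
  finally have "a * a / (c + 1) \<le> 0" by simp
  then have "a * a \<le> 0" using c by (simp add: divide_le_0_iff)
  then have "a = 0" using a by (metis mult_eq_0_iff mult_nonneg_nonneg order_antisym)
  then show ?thesis by (simp add: a_def y_def)
qed

text \<open>The entrywise embedding of real into complex matrices preserves products and the
  identity, hence carries an inverse to an inverse.\<close>

lemma regular_pencil_of_real:
  fixes E A :: "real^'n^'n"
  assumes "invertible (r *\<^sub>R E - A)"
  shows "regular_pencil E A"
proof -
  define c :: "real^'n^'n \<Rightarrow> complex^'n^'n" where "c = (\<lambda>M. \<chi> i j. of_real (M $ i $ j))"
  have mult: "c (M ** N) = c M ** c N" for M N
    by (simp add: c_def matrix_matrix_mult_def vec_eq_iff)
  have one: "c (mat 1) = mat 1"
    by (simp add: c_def mat_def vec_eq_iff)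
  have "pencil_at E A (of_real r) = c (r *\<^sub>R E - A)"
    by (simp add: pencil_at_def c_def vec_eq_iff)
  moreover have "invertible (c (r *\<^sub>R E - A))"
    using assms unfolding invertible_def by (metis mult one)
  ultimately show ?thesis unfolding regular_pencil_def by metis
qed

text \<open>If \<open>n E - A\<close> is singular for every \<open>n\<close>, then any limit point \<open>x\<close> of unit kernel vectors
  \<open>x\<^sub>n\<close> satisfies \<open>E x = lim A x\<^sub>n / n = 0\<close>, and \<open>A x = lim E (n x\<^sub>n)\<close> lies in \<open>im E\<close>, which is closed.\<close>

lemma regular_pencil_if_ker_transversal:
  fixes E A :: "real^'n^'n"
  assumes "\<And>x. E *v x = 0 \<Longrightarrow> A *v x \<in> mat_im E \<Longrightarrow> x = 0"
  shows "regular_pencil E A"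
proof (rule ccontr)
  assume "\<not> regular_pencil E A"
  \<comment> \<open>Sampling at \<open>Suc n\<close> keeps the scalar nonzero, so that
    \<open>E *v u n\<close> can later be recovered from \<open>A *v u n\<close> by division.\<close>
  then have "\<not> invertible (real (Suc n) *\<^sub>R E - A)" for n
    using regular_pencil_of_real by blast
  then have "\<exists>x. x \<noteq> 0 \<and> (real (Suc n) *\<^sub>R E - A) *v x = 0" for n
    by (metis invertible_left_inverse matrix_left_invertible_ker)
  then obtain z where z: "\<And>n. z n \<noteq> 0" "\<And>n. (real (Suc n) *\<^sub>R E - A) *v z n = 0"
    by metis
  define u where "u n = z n /\<^sub>R norm (z n)" for n
  have u: "norm (u n) = 1" for n using z(1) by (simp add: u_def)
  have "A *v z n = real (Suc n) *\<^sub>R (E *v z n)" for n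
    using z(2)[of n]
    by (simp add: matrix_vector_mult_diff_rdistrib scaleR_matrix_vector_assoc[symmetric])
  then have Au: "A *v u n = real (Suc n) *\<^sub>R (E *v u n)" for n
    by (simp add: u_def matrix_vector_mult_scaleR mult.commute)
  have "compact (sphere (0::real^'n) 1)" by simp
  moreover have "\<forall>n. u n \<in> sphere 0 1" using u by simp
  ultimately obtain x s where x: "x \<in> sphere 0 1" and s: "strict_mono s"
    and lim: "(u \<circ> s) \<longlonglongrightarrow> x"
    unfolding compact_def by metis
  have limM: "(\<lambda>n. M *v u (s n)) \<longlonglongrightarrow> M *v x" for M :: "real^'n^'n"
    using bounded_linear.tendsto[OF matrix_vector_mul_bounded_linear lim] by (simp add: o_def)
  have "(\<lambda>n. inverse (real (Suc (s n))) *\<^sub>R (A *v u (s n))) \<longlonglongrightarrow> 0 *\<^sub>R (A *v x)"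
    using LIMSEQ_subseq_LIMSEQ[OF LIMSEQ_inverse_real_of_nat s]
    by (intro tendsto_scaleR limM) (simp add: o_def)
  moreover have "inverse (real (Suc (s n))) *\<^sub>R (A *v u (s n)) = E *v u (s n)" for n
    by (simp add: Au del: of_nat_Suc)
  ultimately have "E *v x = 0"
    using LIMSEQ_unique[OF limM[of E]] by simp
  moreover have "A *v x \<in> mat_im E"
  proof (rule closed_sequentially[OF _ _ limM])
    show "closed (mat_im E)"
      unfolding mat_im_def
      by (intro closed_subspace linear_subspace_image) auto
    show "A *v u (s n) \<in> mat_im E" for n
      unfolding Au mat_im_def by (metis matrix_vector_mult_scaleR rangeI)
  qed
  ultimately have "x = 0" by (rule assms)
  with x show False by simp
qed

text \<open>The index exceeds one exactly when some chain has at least two entries. The first entry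
  of such a chain is a nonzero \<open>x\<close> in ker E with A x in im E, and any such
  \<open>x\<close> starts a chain of length two.\<close>

lemma pencil_index_le_1_iff:
  fixes E A :: "real^'n^'n"
  shows "pencil_index E A \<le> 1 \<longleftrightarrow> (\<forall>x. E *v x = 0 \<longrightarrow> A *v x \<in> mat_im E \<longrightarrow> x = 0)"
proof
  assume le: "pencil_index E A \<le> 1"
  show "\<forall>x. E *v x = 0 \<longrightarrow> A *v x \<in> mat_im E \<longrightarrow> x = 0"
  proof (intro allI impI, rule ccontr)
    fix x assume x: "E *v x = 0" "A *v x \<in> mat_im E" "x \<noteq> 0"
    then obtain y where y: "A *v x = E *v y" by (auto simp: mat_im_def)
    \<comment> \<open>The second entry of a chain must not vanish; adding \<open>x\<close> does not change its image.\<close>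
    define y' where "y' = (if y = 0 then x else y)"
    have "pencil_chain E A [x, y']"
      using x y by (auto simp: pencil_chain_def y'_def)
    then have "enat (length [x, y']) \<le> pencil_index E A"
      unfolding pencil_index_def by (intro SUP_upper) simp
    also note le
    finally show False by (simp add: one_enat_def)
  qed
next
  assume *: "\<forall>x. E *v x = 0 \<longrightarrow> A *v x \<in> mat_im E \<longrightarrow> x = 0"
  have "length xs \<le> 1" if xs: "pencil_chain E A xs" for xs
  proof (rule ccontr)
    assume "\<not> length xs \<le> 1"
    then have len: "1 < length xs" by simp
    then have "E *v (xs ! 1) = A *v (xs ! 0)" "E *v (xs ! 0) = 0" "xs ! 0 \<noteq> 0"
      using xs by (auto simp: pencil_chain_def)
    then show False using * by (metis mat_im_def rangeI)
  qed
  then show "pencil_index E A \<le> 1"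
    unfolding pencil_index_def by (auto simp: SUP_le_iff one_enat_def)
qed

text \<open>The kernel condition encodes the index bound and by itself forces regularity, so the
  conjunction collapses to it.\<close>

lemma regular_index_le_1_iff:
  fixes E A :: "real^'n^'n"
  shows "regular_pencil E A \<and> pencil_index E A \<le> 1 \<longleftrightarrow>
    (\<forall>x. E *v x = 0 \<longrightarrow> A *v x \<in> mat_im E \<longrightarrow> x = 0)"
  using regular_pencil_if_ker_transversal pencil_index_le_1_iff by metis

lemma skew_inner_eq_0:
  fixes J :: "real^'n^'n"
  assumes "J = - transpose J"
  shows "v \<bullet> (J *v v) = 0"
proof -
  have "v \<bullet> (J *v v) = (transpose J *v v) \<bullet> v"
    by (simp add: dot_lmul_matrix)
  also have "transpose J = - J" using assms by (metis minus_minus)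
  also have "(- J *v v) \<bullet> v = - (v \<bullet> (J *v v))"
    \<comment> \<open>Writing \<open>- J\<close> as \<open>0 - J\<close> lets distributivity pull
      out the sign; the form then equals its own negative.\<close>
    using matrix_vector_mult_diff_rdistrib[of 0 J v] by (simp add: inner_commute)
  finally show ?thesis by simp
qed

lemma dissipative_ker:
  fixes J R Q E :: "real^'n^'n"
  assumes J: "J = - transpose J" and R: "pos_semidef R"
    and QE: "transpose Q ** E = transpose E ** Q"
    and x: "E *v x = 0" "((J - R) ** Q) *v x \<in> mat_im E"
  shows "(R ** Q) *v x = 0"
proof -
  obtain y where y: "((J - R) ** Q) *v x = E *v y" using x(2) by (auto simp: mat_im_def)
  define v where "v = Q *v x"
  have adj: "(M *v a) \<bullet> b = a \<bullet> (transpose M *v b)" for M :: "real^'n^'n" and a b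
    by (simp add: dot_lmul_matrix inner_commute[of a] inner_commute[of b])
  have "v \<bullet> (E *v y) = x \<bullet> ((transpose Q ** E) *v y)"
    by (simp only: v_def adj matrix_vector_mul_assoc)
  also have "\<dots> = (E *v x) \<bullet> (Q *v y)"
    by (simp only: QE adj matrix_vector_mul_assoc)
  finally have "v \<bullet> (E *v y) = 0" using x(1) by simp
  \<comment> \<open>The left side is the inner product of \<open>v\<close> with A x = E y, split
    along J - R.\<close>
  then have "v \<bullet> (J *v v) - v \<bullet> (R *v v) = 0"
    by (simp add: y[symmetric] v_def matrix_vector_mult_diff_rdistrib inner_diff_right
        flip: matrix_vector_mul_assoc)
  then have "R *v v = 0"
    using skew_inner_eq_0[OF J] by (intro pos_semidef_mult_eq_0[OF R]) simp
  then show ?thesis by (simp add: v_def flip: matrix_vector_mul_assoc)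
qed

theorem propositionB12:
  fixes J R Q E :: "real^'n^'n"
  assumes "J = - transpose J"
    and "R = transpose R" and "pos_semidef R"
    and "transpose Q ** E = transpose E ** Q" and "pos_semidef (transpose Q ** E)"
  shows "regular_pencil E ((J - R) ** Q) \<and> pencil_index E ((J - R) ** Q) \<le> 1 \<longleftrightarrow>
    mat_ker E \<inter> mat_ker (R ** Q) \<inter> ((*v) (J ** Q)) -` mat_im E = {0}"
proof -
  let ?A = "(J - R) ** Q"
  \<comment> \<open>On ker(RQ) the matrices \<open>?A\<close> and \<open>J ** Q\<close> act alike,
    so the two preimage conditions agree there; \<open>dissipative_ker\<close> places every relevant
    \<open>x\<close> in that kernel.\<close>
  have "?A *v x = (J ** Q) *v x" if "(R ** Q) *v x = 0" for x
    using that by (simp add: matrix_vector_mult_diff_rdistrib flip: matrix_vector_mul_assoc)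
  then have "E *v x = 0 \<and> ?A *v x \<in> mat_im E \<longleftrightarrow>
      x \<in> mat_ker E \<inter> mat_ker (R ** Q) \<inter> ((*v) (J ** Q)) -` mat_im E" for x
    using dissipative_ker[OF assms(1,3,4), of x] unfolding mat_ker_def vimage_def
    by (metis (mono_tags, lifting) IntD1 IntD2 IntI mem_Collect_eq)
  \<comment> \<open>The kernel condition only says that the intersection is contained in
    \<open>{0}\<close>; these facts supply the reverse inclusion.\<close>
  moreover have "E *v 0 = 0" "?A *v 0 \<in> mat_im E"
    by (auto simp: mat_im_def intro: range_eqI[of _ _ 0])
  ultimately show ?thesis
    unfolding regular_index_le_1_iff by blast
qed

end
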